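(* Let $\mathbb{V}$ be a vector space of finite dimension $n>1$ over a field $\mathbb{F}$. If $n$ is odd, $n=2m+1$, then the collection $\mathcal{W}[m]$ of all non-trivial subspaces of $\mathbb{V}$ of dimension less than or equal to $m$ is a maximal independent set in the subspace sum graph $\mathcal{G}(\mathbb{V})$.
   Context: For a finite dimensional vector space $\mathbb{V}$ over a field $\mathbb{F}$ with $\dim(\mathbb{V})>1$, the subspace sum graph $\mathcal{G}(\mathbb{V})$ is the graph whose vertices are the non-trivial proper subspaces of $\mathbb{V}$ (subspaces $W$ with $W\neq\{0\}$ and $W\neq\mathbb{V}$), two vertices $W_1,W_2$ being adjacent if and only if $W_1+W_2=\mathbb{V}$. Non-trivial means different from $\{0\}$. A maximal independent set is an independent set (pairwise non-adjacent vertices) that is maximal with respect to inclusion. *)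

theory Defs
  imports Complex_Main "HOL-Library.Set_Algebras" "Graph_Theory.Pair_Digraph"
begin

text \<open>
  An undirected simple graph, possibly with infinitely many vertices, is a
  \<^term>\<open>pair_bidirected_digraph\<close>: a digraph without parallel arcs whose arc relation is
  symmetric and irreflexive.
\<close>

definition independent_vertices :: "'v pair_pre_digraph \<Rightarrow> 'v set \<Rightarrow> bool"
  where "independent_vertices G S \<longleftrightarrow>
    S \<subseteq> pverts G \<and> pairwise (\<lambda>u v. (u, v) \<notin> parcs G) S"

definition maximal_independent_vertices :: "'v pair_pre_digraph \<Rightarrow> 'v set \<Rightarrow> bool"
  where "maximal_independent_vertices G S \<longleftrightarrow>
    independent_vertices G S \<and> (\<forall>T. independent_vertices G T \<and> S \<subseteq> T \<longrightarrow> T = S)"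

text \<open>
  In the following, the vector space is the whole type \<^typ>\<open>'b\<close> with scalar multiplication
  \<open>scale\<close>, and the sum of two subspaces is the elementwise sum of sets.
\<close>

definition subspace_sum_graph ::
  "('a::field \<Rightarrow> 'b::ab_group_add \<Rightarrow> 'b) \<Rightarrow> 'b set pair_pre_digraph"
  where "subspace_sum_graph scale =
    (let N = {W. module.subspace scale W \<and> W \<noteq> {0} \<and> W \<noteq> UNIV}
     in \<lparr>pverts = N, parcs = {(W\<^sub>1, W\<^sub>2) \<in> N \<times> N. W\<^sub>1 + W\<^sub>2 = UNIV}\<rparr>)"

definition nontrivial_subspaces_dim_le ::
  "('a::field \<Rightarrow> 'b::ab_group_add \<Rightarrow> 'b) \<Rightarrow> nat \<Rightarrow> 'b set set"
  where "nontrivial_subspaces_dim_le scale m =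
    {W. module.subspace scale W \<and> W \<noteq> {0} \<and> vector_space.dim scale W \<le> m}"

lemma (in vector_space) subspace_sum_graph_bidirected:
  "pair_bidirected_digraph (subspace_sum_graph scale)"
proof unfold_locales
  fix e
  assume e: "e \<in> parcs (subspace_sum_graph scale)"
  show "fst e \<in> pverts (subspace_sum_graph scale)"
    and "snd e \<in> pverts (subspace_sum_graph scale)"
    using e by (auto simp: subspace_sum_graph_def Let_def)
next
  show "symmetric (with_proj (subspace_sum_graph scale))"
    by (auto simp: symmetric_def sym_def subspace_sum_graph_def Let_def add.commute)
next
  fix e
  assume e: "e \<in> parcs (subspace_sum_graph scale)"
  have "W + W \<noteq> UNIV" if "subspace W" and "W \<noteq> UNIV" for W
  proof -
    have "W + W \<subseteq> W"
      using that(1) by (auto simp: set_plus_def intro: subspace_add)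
    with that(2) show ?thesis by blast
  qed
  moreover have "subspace (fst e)" and "fst e \<noteq> UNIV" and "fst e + snd e = UNIV"
    using e by (simp_all add: subspace_sum_graph_def Let_def split_beta)
  ultimately show "fst e \<noteq> snd e"
    by metis
qed

end

theory Submission
  imports Defs
begin

text \<open>
  Independence is a dimension count: since \<open>dim (U + W) \<le> dim U + dim W\<close>, two subspaces of
  dimension at most \<open>m\<close> span at most \<open>2m < n\<close> dimensions, so their sum is never the whole space.

  Maximality comes from complements. A non-trivial proper subspace \<open>W\<close> that is left out has
  dimension at least \<open>m + 1\<close> and less than \<open>n\<close>, so any complement of \<open>W\<close> has dimension between
  \<open>1\<close> and \<open>n - (m + 1) = m\<close>. The complement therefore belongs to the collection, and as it
  is adjacent to \<open>W\<close>, no independent set that contains the collection can contain \<open>W\<close>.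
  The two halves meet because \<open>n = 2m + 1\<close> is the
  only dimension with both \<open>2m < n\<close> and \<open>n \<le> 2m + 1\<close>.
\<close>

context finite_dimensional_vector_space
begin

lemma dim_set_plus_le:
  assumes "subspace U" "subspace W"
  shows "dim (U + W) \<le> dim U + dim W"
proof -
  have "U + W = {x + y |x y. x \<in> U \<and> y \<in> W}"
    by (auto simp: set_plus_def)
  then show ?thesis
    using dim_sums_Int[OF assms] by simp
qed

text \<open>
  The complement is spanned by the vectors that extend a basis of \<open>W\<close> to a basis of the whole space.
\<close>

lemma subspace_complement_exists:
  assumes "subspace W"
  obtains C where "subspace C" "W + C = UNIV" "dim W + dim C = dim UNIV"
proof -
  obtain B where B: "finite B" "independent B" "span B = W" "card B = dim W"
    using basis_subspace_exists[OF assms] by metis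
  obtain D where D: "B \<subseteq> D" "independent D" "UNIV \<subseteq> span D"
    using maximal_independent_subset_extend[OF subset_UNIV B(2)] by metis
  show thesis
  proof
    show "subspace (span (D - B))"
      by simp
    have "W + span (D - B) = span (B \<union> (D - B))"
      unfolding span_Un using B(3) by (auto simp: set_plus_def)
    also have "\<dots> = UNIV"
      using D by (simp add: Un_absorb1 top.extremum_unique)
    finally show "W + span (D - B) = UNIV" .
    have "dim (span (D - B)) = card (D - B)"
      using D(2) by (simp add: dim_span_eq_card_independent independent_mono del: dim_span)
    moreover have "dim UNIV = card D"
      using D(2,3) by (metis basis_card_eq_dim subset_UNIV)
    moreover have "card (D - B) = card D - card B" "card B \<le> card D"
      using D B(1) finiteI_independent by (auto simp: card_Diff_subset card_mono)
    ultimately show "dim W + dim (span (D - B)) = dim UNIV"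
      using B(4) by linarith
  qed
qed

lemma independent_vertices_dim_le:
  assumes "2 * m < dim UNIV"
  shows "independent_vertices (subspace_sum_graph scale) (nontrivial_subspaces_dim_le scale m)"
proof -
  have "U + W \<noteq> UNIV" if "subspace U" "subspace W" "dim U \<le> m" "dim W \<le> m" for U W
    using dim_set_plus_le[OF that(1,2)] that(3,4) assms by auto
  moreover have "W \<noteq> UNIV" if "dim W \<le> m" for W
    using that assms by auto
  ultimately show ?thesis
    unfolding independent_vertices_def subspace_sum_graph_def nontrivial_subspaces_dim_le_def
      pairwise_def Let_def
    by auto
qed

lemma adjacent_to_small_subspace:
  assumes "dim UNIV \<le> 2 * m + 1"
    and "W \<in> pverts (subspace_sum_graph scale)" "W \<notin> nontrivial_subspaces_dim_le scale m"
  obtains C where "C \<in> nontrivial_subspaces_dim_le scale m"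
    and "(W, C) \<in> parcs (subspace_sum_graph scale)"
proof -
  have W: "subspace W" "W \<noteq> {0}" "W \<noteq> UNIV" "m < dim W"
    using assms(2,3)
    by (auto simp: subspace_sum_graph_def nontrivial_subspaces_dim_le_def Let_def)
  obtain C where C: "subspace C" "W + C = UNIV" "dim W + dim C = dim UNIV"
    using subspace_complement_exists[OF W(1)] .
  have "C \<noteq> {0}"
    using C(2) W(3) by (auto simp: set_plus_def)
  moreover have "C \<noteq> UNIV"
    using C(3) W(4) by (metis add_cancel_left_left not_less_zero)
  moreover have "dim C \<le> m"
    using C(3) W(4) assms(1) by linarith
  ultimately show thesis
    using that[of C] W C
    by (simp add: subspace_sum_graph_def nontrivial_subspaces_dim_le_def Let_def)
qed

end

theorem theorem4p2:
  fixes scale :: "'a::field \<Rightarrow> 'b::ab_group_add \<Rightarrow> 'b"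
    and Basis :: "'b set"
    and n m :: nat
  assumes "finite_dimensional_vector_space scale Basis"
    and "vector_space.dim scale UNIV = n"
    and "n > 1"
    and "n = 2 * m + 1"
  shows "maximal_independent_vertices (subspace_sum_graph scale)
           (nontrivial_subspaces_dim_le scale m)"
proof -
  interpret finite_dimensional_vector_space scale Basis
    by (rule assms(1))
  let ?G = "subspace_sum_graph scale" and ?S = "nontrivial_subspaces_dim_le scale m"
  have "T \<subseteq> ?S" if T: "independent_vertices ?G T" "?S \<subseteq> T" for T
  proof
    fix W
    assume "W \<in> T"
    show "W \<in> ?S"
    proof (rule ccontr)
      assume "W \<notin> ?S"
      moreover have "W \<in> pverts ?G"
        using T(1) \<open>W \<in> T\<close> by (auto simp: independent_vertices_def)
      ultimately obtain C where "C \<in> ?S" "(W, C) \<in> parcs ?G"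
        using adjacent_to_small_subspace[of m W] assms(2,4) by (metis order_refl)
      moreover have "W \<noteq> C"
        using \<open>C \<in> ?S\<close> \<open>W \<notin> ?S\<close> by blast
      ultimately show False
        using T \<open>W \<in> T\<close> unfolding independent_vertices_def pairwise_def by blast
    qed
  qed
  moreover have "independent_vertices ?G ?S"
    using independent_vertices_dim_le[of m] assms(2,4) by linarith
  ultimately show ?thesis
    unfolding maximal_independent_vertices_def by blast
qed

end
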